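(* Let $\omega$ be a weight function with class $\overline\omega=\{\lambda\omega:\lambda>0\}$, and assume $\limsup_{t\to\infty}\frac{\omega(t)}{t^2}<\frac12$. There exist $\overline{C}<\infty$, depending only on $\overline\omega$, and $C<\infty$ (which may depend on $\omega$), such that for all $f\in\mathcal{S}_{\overline{C}\omega}$, $$\sqrt{\sup_{q,p\in\mathbb{R}}|\Phi(f,f)(q,p)|\,e^{2(\omega(|q|)+\omega(|p|))}}\ \le\ C\,\|f\|_{\overline{C}\omega}.$$
   Context: Weight function: a continuous increasing function $\omega:[0,\infty)\to[0,\infty)$ such that (i) $t\mapsto\omega(e^t)$ is convex; (ii) $\log t = o(\omega(t))$ as $t\to\infty$; (iii) $\omega(2t)=O(\omega(t))$ as $t\to\infty$; (iv) $\limsup_{t\to\infty}\omega(t)/t^2\le \frac12$. Fourier transform: $\widehat f(\xi)=(2\pi)^{-1/2}\int f(x)e^{-i\xi x}\,dx$. For $\lambda>0$, $\mathcal{S}_{\lambda\omega}$ is the Banach space of $f\in L^2(\mathbb{R})$ (complex-valued) with $f(x)=O(e^{-\lambda\omega(|x|)})$ and $\widehat f(\xi)=O(e^{-\lambda\omega(|\xi|)})$, with norm $\|f\|_{\lambda\omega}=\|f(x)e^{\lambda\omega(|x|)}\|_\infty+\|\widehat f(\xi)e^{\lambda\omega(|\xi|)}\|_\infty$. The Wigner transform of $f\in L^2(\mathbb{R})$ is $\Phi(f,f)(q,p)=\frac1{2\pi}\int e^{ipx}f(q-\tfrac x2)\overline{f(q+\tfrac x2)}\,dx$. *)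

theory Defs
  imports "HOL-Probability.Essential_Supremum" "HOL-Library.Landau_Symbols"
begin

text \<open>
  A function on $[0,\infty)$ is represented by a total function on the reals of which only the values
  on $[0,\infty)$ are ever used. An increasing function is one that is monotone, not necessarily strictly.
\<close>

definition weight_function :: "(real \<Rightarrow> real) \<Rightarrow> bool" where
  "weight_function \<omega> \<longleftrightarrow>
     continuous_on {0..} \<omega> \<and>
     mono_on {0..} \<omega> \<and>
     (\<forall>t\<ge>0. 0 \<le> \<omega> t) \<and>
     convex_on UNIV (\<lambda>t. \<omega> (exp t)) \<and>
     ln \<in> o[at_top](\<omega>) \<and>
     (\<lambda>t. \<omega> (2 * t)) \<in> O[at_top](\<omega>) \<and>
     Limsup at_top (\<lambda>t. ereal (\<omega> t / t\<^sup>2)) \<le> ereal (1 / 2)"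

text \<open>
  The set of all $\lambda\omega$, $\lambda > 0$. Equality is only required on $[0,\infty)$, so that the class
  does not depend on the irrelevant values of $\omega$ at negative arguments.
\<close>

definition weight_class :: "(real \<Rightarrow> real) \<Rightarrow> (real \<Rightarrow> real) set" where
  "weight_class \<omega> = {\<eta>. \<exists>c>0. \<forall>t\<ge>0. \<eta> t = c * \<omega> t}"

text \<open>
  The integral formula defines the Fourier transform of integrable functions. It suffices here: a function
  that is $O(e^{-\lambda\omega(|x|)})$ is integrable, because $\log t = o(\omega(t))$.
\<close>

definition fourier_transform :: "(real \<Rightarrow> complex) \<Rightarrow> real \<Rightarrow> complex" where
  "fourier_transform f \<xi> =
     complex_of_real (1 / sqrt (2 * pi)) * (LINT x|lborel. f x * exp (- \<i> * of_real (\<xi> * x)))"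

text \<open>
  Elements of $L^2$ are given by Borel measurable representatives, and pointwise bounds are meant almost
  everywhere. The $O$-bounds are global ones, as required for the norm below to be finite.
\<close>

definition S_space :: "real \<Rightarrow> (real \<Rightarrow> real) \<Rightarrow> (real \<Rightarrow> complex) set" where
  "S_space l \<omega> = {f.
     f \<in> borel_measurable lborel \<and>
     integrable lborel (\<lambda>x. (cmod (f x))\<^sup>2) \<and>
     (\<exists>M. AE x in lborel. cmod (f x) \<le> M * exp (- l * \<omega> \<bar>x\<bar>)) \<and>
     (\<exists>M. AE \<xi> in lborel. cmod (fourier_transform f \<xi>) \<le> M * exp (- l * \<omega> \<bar>\<xi>\<bar>))}"

text \<open>Both essential suprema are finite on \<^term>\<open>S_space l \<omega>\<close> when \<^term>\<open>\<omega>\<close> is a weight function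
  and \<^term>\<open>l > 0\<close>.\<close>

definition S_norm :: "real \<Rightarrow> (real \<Rightarrow> real) \<Rightarrow> (real \<Rightarrow> complex) \<Rightarrow> real" where
  "S_norm l \<omega> f =
     real_of_ereal (esssup lborel (\<lambda>x. ereal (cmod (f x * of_real (exp (l * \<omega> \<bar>x\<bar>)))))) +
     real_of_ereal (esssup lborel
       (\<lambda>\<xi>. ereal (cmod (fourier_transform f \<xi> * of_real (exp (l * \<omega> \<bar>\<xi>\<bar>))))))"

definition wigner :: "(real \<Rightarrow> complex) \<Rightarrow> real \<Rightarrow> real \<Rightarrow> complex" where
  "wigner f q p =
     complex_of_real (1 / (2 * pi)) *
     (LINT x|lborel. exp (\<i> * of_real (p * x)) * f (q - x / 2) * cnj (f (q + x / 2)))"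

end

theory Submission
  imports Defs "HOL-Probability.Characteristic_Functions" "HOL-Probability.Sinc_Integral"
begin

text \<open>
  The constant 4 serves for every class. With \<open>y = q - x / 2\<close> the Wigner transform becomes
  \<open>1 / \<pi>\<close> times the integral of \<open>f(y) cnj (f(2q - y))\<close> against a phase; by Fourier inversion and Fubini it
  equals the same expression in the Fourier transform of \<open>f\<close>, with \<open>p\<close> in place of \<open>q\<close>. As one of \<open>y\<close>
  and \<open>2q - y\<close> has modulus at least \<open>\<bar>q\<bar>\<close>, these two forms give decay of order \<open>exp (- 4 \<omega>(q))\<close> and
  \<open>exp (- 4 \<omega>(p))\<close>, and the geometric mean of the two bounds is the assertion.
\<close>

section \<open>Exchange of integrals against a bounded kernel\<close>

lemma integrable_product_kernel:
  fixes u v :: "real \<Rightarrow> complex" and K :: "real \<Rightarrow> real \<Rightarrow> complex"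
  assumes u: "integrable lborel u" and v: "integrable lborel v"
    and K[measurable]: "case_prod K \<in> borel_measurable (lborel \<Otimes>\<^sub>M lborel)"
    and bound: "\<And>x y. cmod (K x y) \<le> C"
  shows "integrable (lborel \<Otimes>\<^sub>M lborel) (\<lambda>(x, y). u x * v y * K x y)"
proof -
  have [measurable]: "u \<in> borel_measurable borel" "v \<in> borel_measurable borel"
    using u v by auto
  have "integrable (lborel \<Otimes>\<^sub>M lborel) (\<lambda>(x, y). u x * v y)"
    using u v by (intro lborel_pair.Fubini_integrable) (auto simp: norm_mult)
  then have "integrable (lborel \<Otimes>\<^sub>M lborel) (\<lambda>z. of_real C * (case z of (x, y) \<Rightarrow> u x * v y))"
    by (rule integrable_mult_right)
  then show ?thesis
  proof (rule Bochner_Integration.integrable_bound)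
    show "AE z in lborel \<Otimes>\<^sub>M lborel. norm (case z of (x, y) \<Rightarrow> u x * v y * K x y)
        \<le> norm (of_real C * (case z of (x, y) \<Rightarrow> u x * v y))"
    proof (intro AE_I2)
      fix z :: "real \<times> real"
      obtain x y where z: "z = (x, y)" by fastforce
      have "cmod (K x y) \<le> \<bar>C\<bar>" using bound[of x y] by linarith
      then show "norm (case z of (x, y) \<Rightarrow> u x * v y * K x y)
        \<le> norm (of_real C * (case z of (x, y) \<Rightarrow> u x * v y))"
        by (auto simp: z norm_mult mult.commute intro!: mult_right_mono)
    qed
  qed measurable
qed

text \<open>All three exchanges of integration below have this shape: integrable functions of
  separate variables, coupled by a bounded factor (a phase or a normal density). Absolute
  integrability comes from \<open>u x * v y\<close> times the bound \<open>C\<close>.\<close>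

lemma Fubini_product_kernel:
  fixes u v :: "real \<Rightarrow> complex" and K :: "real \<Rightarrow> real \<Rightarrow> complex"
  assumes "integrable lborel u" and "integrable lborel v"
    and "case_prod K \<in> borel_measurable (lborel \<Otimes>\<^sub>M lborel)"
    and "\<And>x y. cmod (K x y) \<le> C"
  shows "(LINT x|lborel. u x * (LINT y|lborel. v y * K x y))
    = (LINT y|lborel. v y * (LINT x|lborel. u x * K x y))"
proof -
  have "(LINT x|lborel. LINT y|lborel. u x * v y * K x y)
      = (LINT y|lborel. LINT x|lborel. u x * v y * K x y)"
    using lborel_pair.Fubini_integral[OF integrable_product_kernel[OF assms]] by simp
  moreover have "(LINT y|lborel. u x * v y * K x y) = u x * (LINT y|lborel. v y * K x y)" for x
    by (simp add: mult.assoc flip: integral_mult_right_zero)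
  moreover have "(LINT x|lborel. u x * v y * K x y) = v y * (LINT x|lborel. u x * K x y)" for y
    by (simp add: mult.assoc mult.left_commute flip: integral_mult_right_zero)
  ultimately show ?thesis by simp
qed

section \<open>Gaussian regularisation of the inverse Fourier transform\<close>

text \<open>This is the characteristic function of the standard normal law at
  \<open>u / \<epsilon>\<close>; the substitution \<open>z = \<epsilon> * \<xi>\<close> turns its
  phase into \<open>u * \<xi>\<close>. Writing the result as a normal density prepares its use as an
  approximate identity.\<close>

lemma gaussian_fourier_integral:
  assumes "\<epsilon> > 0"
  shows "(LINT \<xi>|lborel. complex_of_real (exp (- (\<epsilon> * \<xi>)\<^sup>2 / 2)) * iexp (u * \<xi>))
    = of_real (2 * pi * normal_density 0 \<epsilon> u)"
proof -
  have "exp (- (u / \<epsilon>)\<^sup>2 / 2) = char std_normal_distribution (u / \<epsilon>)"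
    by (simp add: char_std_normal_distribution)
  also have "\<dots> = (LINT z|lborel. std_normal_density z *\<^sub>R iexp (u / \<epsilon> * z))"
    unfolding char_def by (subst integral_density) auto
  also have "\<dots> = \<epsilon> *\<^sub>R (LINT \<xi>|lborel. std_normal_density (\<epsilon> * \<xi>) *\<^sub>R iexp (u / \<epsilon> * (\<epsilon> * \<xi>)))"
    using assms by (subst lborel_integral_real_affine[where c = \<epsilon> and t = 0]) auto
  also have "(\<lambda>\<xi>. std_normal_density (\<epsilon> * \<xi>) *\<^sub>R iexp (u / \<epsilon> * (\<epsilon> * \<xi>)))
      = (\<lambda>\<xi>. complex_of_real (1 / sqrt (2 * pi)) *
          (complex_of_real (exp (- (\<epsilon> * \<xi>)\<^sup>2 / 2)) * iexp (u * \<xi>)))"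
    using assms by (auto simp: std_normal_density_def scaleR_conv_of_real)
  finally have "complex_of_real (exp (- (u / \<epsilon>)\<^sup>2 / 2)) = of_real (\<epsilon> / sqrt (2 * pi)) *
      (LINT \<xi>|lborel. complex_of_real (exp (- (\<epsilon> * \<xi>)\<^sup>2 / 2)) * iexp (u * \<xi>))"
    by (simp add: scaleR_conv_of_real)
  then have "(LINT \<xi>|lborel. complex_of_real (exp (- (\<epsilon> * \<xi>)\<^sup>2 / 2)) * iexp (u * \<xi>))
      = of_real (sqrt (2 * pi) / \<epsilon> * exp (- (u / \<epsilon>)\<^sup>2 / 2))"
    using assms by (simp add: field_simps)
  also have "sqrt (2 * pi) / \<epsilon> * exp (- (u / \<epsilon>)\<^sup>2 / 2) = 2 * pi * normal_density 0 \<epsilon> u"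
    using assms by (simp add: normal_density_def real_sqrt_mult field_simps power_divide)
  finally show ?thesis .
qed

lemma integrable_gaussian:
  assumes "\<epsilon> > 0"
  shows "integrable lborel (\<lambda>\<xi>. complex_of_real (exp (- (\<epsilon> * \<xi>)\<^sup>2 / 2)))"
proof -
  have "integrable lborel (\<lambda>z. sqrt (2 * pi) * std_normal_density z)"
    by (intro integrable_mult_right integrable_normal_density) simp
  from lborel_integrable_real_affine[OF this, of \<epsilon> 0] assms show ?thesis
    by (subst complex_of_real_integrable_eq) (simp add: std_normal_density_def)
qed

lemma borel_measurable_fourier_transform [measurable]:
  assumes [measurable]: "f \<in> borel_measurable borel"
  shows "fourier_transform f \<in> borel_measurable borel"
  unfolding fourier_transform_def[abs_def] by measurable

text \<open>The Gaussian factor makes the double integral in \<open>y\<close> and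
  \<open>\<xi>\<close> absolutely convergent. After the exchange, the integral over
  \<open>\<xi>\<close> is the Gaussian one above at \<open>u = x - y\<close>.\<close>

lemma fourier_transform_gaussian_inversion:
  assumes f: "integrable lborel f" and "\<epsilon> > 0"
  shows "(LINT \<xi>|lborel. fourier_transform f \<xi> * iexp (x * \<xi>) * of_real (exp (- (\<epsilon> * \<xi>)\<^sup>2 / 2)))
    = of_real (sqrt (2 * pi)) * (LINT y|lborel. f y * of_real (normal_density 0 \<epsilon> (x - y)))"
proof -
  let ?g = "\<lambda>\<xi>. complex_of_real (exp (- (\<epsilon> * \<xi>)\<^sup>2 / 2))"
  have kernel: "f y * iexp ((x - y) * \<xi>) = iexp (x * \<xi>) * (f y * exp (- \<i> * of_real (\<xi> * y)))" for y \<xi>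
    by (simp add: mult.left_commute flip: exp_add) (simp add: algebra_simps)
  have "fourier_transform f \<xi> * iexp (x * \<xi>) * ?g \<xi>
      = of_real (1 / sqrt (2 * pi)) * (?g \<xi> * (LINT y|lborel. f y * iexp ((x - y) * \<xi>)))" for \<xi>
    by (simp only: kernel integral_mult_right_zero fourier_transform_def) (simp add: ac_simps)
  then have "(LINT \<xi>|lborel. fourier_transform f \<xi> * iexp (x * \<xi>) * ?g \<xi>)
      = of_real (1 / sqrt (2 * pi)) *
        (LINT \<xi>|lborel. ?g \<xi> * (LINT y|lborel. f y * iexp ((x - y) * \<xi>)))"
    by (simp only: integral_mult_right_zero)
  also have "(LINT \<xi>|lborel. ?g \<xi> * (LINT y|lborel. f y * iexp ((x - y) * \<xi>)))
      = (LINT y|lborel. f y * (LINT \<xi>|lborel. ?g \<xi> * iexp ((x - y) * \<xi>)))"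
    using f integrable_gaussian[OF assms(2)]
    by (intro Fubini_product_kernel[where C = 1]) auto
  also have "\<dots> = (LINT y|lborel. of_real (2 * pi) * (f y * of_real (normal_density 0 \<epsilon> (x - y))))"
    by (simp only: gaussian_fourier_integral[OF assms(2)]) (simp add: ac_simps)
  also have "\<dots> = of_real (2 * pi) * (LINT y|lborel. f y * of_real (normal_density 0 \<epsilon> (x - y)))"
    by (rule integral_mult_right_zero)
  also have "of_real (1 / sqrt (2 * pi)) * (of_real (2 * pi) * z) = of_real (sqrt (2 * pi)) * z" for z :: complex
    by (simp add: real_div_sqrt mult.assoc[symmetric] flip: of_real_mult of_real_divide)
  finally show ?thesis .
qed

text \<open>Under \<open>x = y + \<epsilon> * z\<close> the density becomes the fixed standard one
  and \<open>\<epsilon>\<close> moves into the argument of the indicator, which is continuous at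
  \<open>y\<close> away from the endpoints. The standard density dominates.\<close>

lemma gaussian_smoothed_indicator:
  fixes a b y :: real
  assumes "y \<noteq> a" "y \<noteq> b"
  shows "(\<lambda>n. LINT x|lborel. indicator {a<..<b} x * normal_density 0 (inverse (real (Suc n))) (x - y))
    \<longlonglongrightarrow> indicator {a<..<b} y"
proof -
  let ?e = "\<lambda>n. inverse (real (Suc n))"
  have e: "?e n > 0" for n by simp
  have eq: "(LINT x|lborel. indicator {a<..<b} x * normal_density 0 \<epsilon> (x - y))
      = (LINT z|lborel. indicator {a<..<b} (y + \<epsilon> * z) * std_normal_density z)"
    if "\<epsilon> > 0" for \<epsilon>
  proof -
    have "normal_density 0 \<epsilon> (\<epsilon> * z) = std_normal_density z / \<epsilon>" for z
      using that by (simp add: normal_density_def real_sqrt_mult power_mult_distrib)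
    then show ?thesis
      using that by (subst lborel_integral_real_affine[where c = \<epsilon> and t = y])
        simp_all
  qed
  have "(\<lambda>n. LINT z|lborel. indicator {a<..<b} (y + ?e n * z) * std_normal_density z)
      \<longlonglongrightarrow> (LINT z|lborel. indicator {a<..<b} y * std_normal_density z)"
  proof (rule integral_dominated_convergence[where w = std_normal_density])
    show "AE z in lborel. (\<lambda>n. indicator {a<..<b} (y + ?e n * z) * std_normal_density z)
        \<longlonglongrightarrow> indicator {a<..<b} y * std_normal_density z"
    proof (intro AE_I2 tendsto_mult tendsto_const)
      fix z
      have lim: "(\<lambda>n. y + ?e n * z) \<longlonglongrightarrow> y + 0 * z"
        by (intro tendsto_intros LIMSEQ_inverse_real_of_nat)
      have "isCont (indicator {a<..<b} :: real \<Rightarrow> real) y"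
        using assms by (cases "a < b") (auto simp: isCont_indicator frontier_def)
      from isCont_tendsto_compose[OF this] lim
      show "(\<lambda>n. indicator {a<..<b} (y + ?e n * z) :: real) \<longlonglongrightarrow> indicator {a<..<b} y"
        by simp
    qed
  qed (auto simp: indicator_def)
  then show ?thesis unfolding eq[OF e] by simp
qed

section \<open>Almost everywhere Fourier inversion\<close>

text \<open>Half-lines form an intersection-stable generator of the Borel sets, so a Dynkin argument
  spreads vanishing integrals from them to all Borel sets, which forces the function to vanish
  almost everywhere.\<close>

lemma AE_zero_if_interval_integrals_zero:
  fixes d :: "real \<Rightarrow> complex"
  assumes d: "\<And>a b. set_integrable lborel {a<..<b} d"
    and zero: "\<And>a b. (LINT x:{a<..<b}|lborel. d x) = 0"
  shows "AE x in lborel. d x = 0"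
proof -
  have "AE x in lborel. indicator {- real n<..<real n} x *\<^sub>R d x = 0" for n
  proof -
    \<comment> \<open>Integrability is given only on bounded intervals; the cut-off is integrable on
      the whole line, as complements and countable unions require. Countably many windows then
      exhaust the line.\<close>
    let ?d = "\<lambda>x. indicator {- real n<..<real n} x *\<^sub>R d x"
    have int: "integrable lborel ?d" using d unfolding set_integrable_def .
    have set_int: "set_integrable lborel A ?d" if "A \<in> sets borel" for A
      unfolding set_integrable_def using integrable_mult_indicator[OF _ int, of A] that by simp
    have total: "(LINT x|lborel. ?d x) = 0" using zero unfolding set_lebesgue_integral_def .
    have sets: "(sets borel :: real set set) = sigma_sets UNIV (range lessThan)"
      by (simp add: borel_Iio)
    have "{..<a} \<inter> {..<b} = {..<min a b}" for a b :: real by auto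
    then have stable: "Int_stable (range lessThan :: real set set)"
      by (auto simp: Int_stable_def)
    have "(LINT x:A|lborel. ?d x) = 0" if "A \<in> sets borel" for A
    proof -
      note stable
      moreover have "range lessThan \<subseteq> Pow (UNIV :: real set)" by simp
      moreover have "A \<in> sigma_sets UNIV (range lessThan)" using that sets by simp
      ultimately show ?thesis
      proof (induction rule: sigma_sets_induct_disjoint)
        case (basic A)
        then obtain c where "A = {..<c}" by auto
        \<comment> \<open>A half-line meets the window in an open interval, possibly empty, so the
          hypothesis on \<open>d\<close> covers the generators.\<close>
        then have "(LINT x:A|lborel. ?d x) = (LINT x:{- real n<..<min c (real n)}|lborel. d x)"
          unfolding set_lebesgue_integral_def
          by (intro Bochner_Integration.integral_cong) (auto simp: indicator_def)
        then show ?case using zero by simp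
      next
        case (compl A)
        then have A: "A \<in> sets borel" using sets by simp
        have "(LINT x|lborel. ?d x) = (LINT x:A|lborel. ?d x) + (LINT x:UNIV - A|lborel. ?d x)"
          using set_integral_Un[of A "UNIV - A" lborel ?d] set_int[OF A] set_int[of "UNIV - A"] A
          by (simp add: set_lebesgue_integral_def)
        then show ?case using compl total by simp
      next
        case (union A)
        then have A: "A i \<in> sets borel" for i using sets by auto
        have "(LINT x:(\<Union>i. A i)|lborel. ?d x) = (\<Sum>i. (LINT x:A i|lborel. ?d x))"
          using union A set_int by (intro lebesgue_integral_countable_add) (auto simp: disjoint_family_on_def)
        then show ?case using union by simp
      qed (auto simp: set_lebesgue_integral_def)
    qed
    then show ?thesis using int by (intro sigma_finite_measure.density_zero[OF lborel.sigma_finite_measure_axioms]) auto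
  qed
  then have "AE x in lborel. \<forall>n. indicator {- real n<..<real n} x *\<^sub>R d x = 0"
    by (subst AE_all_countable) blast
  then show ?thesis
  proof eventually_elim
    case (elim x)
    obtain n where "\<bar>x\<bar> < real n" using reals_Archimedean2 by blast
    then have "x \<in> {- real n<..<real n}" by auto
    with elim[rule_format, of n] show ?case by simp
  qed
qed

lemma emeasure_lborel_Ioo_less_top: "emeasure lborel {a<..<b :: real} < top"
  by (cases "a \<le> b") (simp_all add: greaterThanLessThan_empty)

text \<open>
  Gaussian means of the inversion integral converge to it pointwise; being convolutions of \<open>f\<close> with
  Gaussians, they also converge to \<open>f\<close> when integrated over an interval.
\<close>

theorem fourier_inversion_AE:
  assumes f: "integrable lborel f" and g: "integrable lborel (fourier_transform f)"
  shows "AE x in lborel. f x =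
    of_real (1 / sqrt (2 * pi)) * (LINT \<xi>|lborel. fourier_transform f \<xi> * iexp (x * \<xi>))"
proof -
  let ?e = "\<lambda>n. inverse (real (Suc n))"
  \<comment> \<open>\<open>h\<close> is the claimed inverse transform, \<open>B n\<close> its
    Gaussian mean with damping parameter \<open>?e n\<close>, and \<open>M\<close> bounds both once
    phases and damping are estimated by 1.\<close>
  define h where "h x = of_real (1 / sqrt (2 * pi)) * (LINT \<xi>|lborel. fourier_transform f \<xi> * iexp (x * \<xi>))" for x
  define B where "B n x = of_real (1 / sqrt (2 * pi)) *
    (LINT \<xi>|lborel. fourier_transform f \<xi> * iexp (x * \<xi>) * of_real (exp (- (?e n * \<xi>)\<^sup>2 / 2)))" for n x
  define M where "M = 1 / sqrt (2 * pi) * (LINT \<xi>|lborel. cmod (fourier_transform f \<xi>))"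
  have [measurable]: "f \<in> borel_measurable borel" using f by auto
  have [measurable]: "h \<in> borel_measurable borel" "B n \<in> borel_measurable borel" for n
    unfolding h_def[abs_def] B_def[abs_def] by measurable
  have h_bound: "cmod (h x) \<le> M" for x
    unfolding h_def M_def norm_mult
    by (intro mult_mono order_trans[OF integral_norm_bound]) (auto simp: norm_mult norm_divide)
  have B_bound: "cmod (B n x) \<le> M" for n x
  proof -
    have "cmod (LINT \<xi>|lborel. fourier_transform f \<xi> * iexp (x * \<xi>) * of_real (exp (- (?e n * \<xi>)\<^sup>2 / 2)))
        \<le> (LINT \<xi>|lborel. cmod (fourier_transform f \<xi>))"
      using g by (intro Bochner_Integration.integral_norm_bound_integral Bochner_Integration.integrable_bound[OF g])
        (auto simp: norm_mult mult_left_le)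
    then show ?thesis
      unfolding B_def M_def norm_mult by (intro mult_mono) (auto simp: norm_divide)
  qed
  \<comment> \<open>The same means in position space: convolutions of \<open>f\<close> with normal
    densities whose width tends to 0.\<close>
  have B_eq: "B n x = (LINT y|lborel. f y * of_real (normal_density 0 (?e n) (x - y)))" for n x
    unfolding B_def
    by (subst fourier_transform_gaussian_inversion[OF f]) (auto simp flip: mult.assoc of_real_mult)
  have B_lim: "(\<lambda>n. B n x) \<longlonglongrightarrow> h x" for x
    unfolding B_def h_def
  proof (intro tendsto_mult tendsto_const
      integral_dominated_convergence[where w = "\<lambda>\<xi>. cmod (fourier_transform f \<xi>)"])
    show "AE \<xi> in lborel. (\<lambda>n. fourier_transform f \<xi> * iexp (x * \<xi>) * of_real (exp (- (?e n * \<xi>)\<^sup>2 / 2)))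
        \<longlonglongrightarrow> fourier_transform f \<xi> * iexp (x * \<xi>)"
    proof (intro AE_I2)
      fix \<xi>
      have "(\<lambda>n. fourier_transform f \<xi> * iexp (x * \<xi>) * of_real (exp (- (?e n * \<xi>)\<^sup>2 / 2)))
        \<longlonglongrightarrow> fourier_transform f \<xi> * iexp (x * \<xi>) * of_real (exp (- (0 * \<xi>)\<^sup>2 / 2))"
        by (intro tendsto_intros LIMSEQ_inverse_real_of_nat) simp
      then show "(\<lambda>n. fourier_transform f \<xi> * iexp (x * \<xi>) * of_real (exp (- (?e n * \<xi>)\<^sup>2 / 2)))
        \<longlonglongrightarrow> fourier_transform f \<xi> * iexp (x * \<xi>)" by simp
    qed
  qed (use g in \<open>auto simp: norm_mult mult_left_le\<close>)
  \<comment> \<open>Boundedness gives integrability of \<open>h\<close> on bounded intervals; on the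
    whole line it is not yet known, hence the comparison interval by interval.\<close>
  have h_int: "set_integrable lborel {a<..<b} h" for a b
    unfolding set_integrable_def
    by (intro integrableI_bounded_set_indicator[where B = M]) (auto simp: h_bound emeasure_lborel_Ioo_less_top)
  have f_int: "set_integrable lborel {a<..<b} f" for a b
    unfolding set_integrable_def using f by (intro integrable_mult_indicator) auto
  \<comment> \<open>Both sides turn out to be limits of the integrals of \<open>B n\<close> over the
    interval.\<close>
  have "(LINT x:{a<..<b}|lborel. f x) = (LINT x:{a<..<b}|lborel. h x)" for a b
  proof -
    let ?J = "\<lambda>n y. LINT x|lborel. indicator {a<..<b} x * normal_density 0 (?e n) (x - y)"
    have ind: "integrable lborel (indicator {a<..<b} :: real \<Rightarrow> complex)"
      using integrable_of_real[where 'a = complex, OF integrable_real_indicator[of "{a<..<b}" lborel]]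
      by (simp add: of_real_indicator emeasure_lborel_Ioo_less_top)
    \<comment> \<open>Fubini moves the smoothing from \<open>f\<close> onto the indicator, whose
      pointwise limit is explicit.\<close>
    have swap: "(LINT x:{a<..<b}|lborel. B n x) = (LINT y|lborel. f y * of_real (?J n y))" for n
    proof -
      have "(LINT x:{a<..<b}|lborel. B n x)
          = (LINT x|lborel. indicator {a<..<b} x * (LINT y|lborel. f y * of_real (normal_density 0 (?e n) (x - y))))"
        unfolding set_lebesgue_integral_def B_eq
        by (intro Bochner_Integration.integral_cong) (auto simp: indicator_def)
      \<comment> \<open>The kernel bound is the height of the normal density at its centre.\<close>
      also have "\<dots> = (LINT y|lborel. f y * (LINT x|lborel. indicator {a<..<b} x * of_real (normal_density 0 (?e n) (x - y))))"
        using ind f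
        by (rule Fubini_product_kernel[where C = "1 / sqrt (2 * pi * (?e n)\<^sup>2)"])
          (auto simp: normal_density_def norm_mult norm_divide divide_right_mono)
      also have "\<dots> = (LINT y|lborel. f y * of_real (?J n y))"
      proof -
        have "(LINT x|lborel. indicator {a<..<b} x * complex_of_real (normal_density 0 (?e n) (x - y)))
            = of_real (?J n y)" for y
          by (simp add: of_real_indicator flip: integral_complex_of_real)
        then show ?thesis by (simp only:)
      qed
      finally show ?thesis .
    qed
    \<comment> \<open>The density has total mass 1, so \<open>cmod (f y)\<close> dominates the
      integrands below.\<close>
    have J_bound: "cmod (of_real (?J n y)) \<le> 1" for n y
    proof -
      have dens: "integrable lborel (\<lambda>x. normal_density y (?e n) x)" by simp
      have shift: "normal_density 0 (?e n) (x - y) = normal_density y (?e n) x" for x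
        by (simp add: normal_density_def)
      have "norm (?J n y) \<le> (LINT x|lborel. normal_density y (?e n) x)"
        unfolding shift
        by (intro Bochner_Integration.integral_norm_bound_integral Bochner_Integration.integrable_bound[OF dens] dens)
          (auto simp: indicator_def)
      then show ?thesis by simp
    qed
    have "(\<lambda>n. LINT y|lborel. f y * of_real (?J n y)) \<longlonglongrightarrow> (LINT y|lborel. f y * of_real (indicator {a<..<b} y))"
    proof (rule integral_dominated_convergence[where w = "\<lambda>y. cmod (f y)"])
      show "AE y in lborel. (\<lambda>n. f y * of_real (?J n y)) \<longlonglongrightarrow> f y * of_real (indicator {a<..<b} y)"
        \<comment> \<open>The endpoints, where the limit of the smoothed indicator is not
          controlled, form a null set.\<close>
        using AE_lborel_singleton[of a] AE_lborel_singleton[of b]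
        by eventually_elim (intro tendsto_mult tendsto_const tendsto_of_real gaussian_smoothed_indicator)
      show "AE y in lborel. norm (f y * of_real (?J n y)) \<le> cmod (f y)" for n
        using J_bound by (intro AE_I2) (simp only: norm_mult mult_left_le norm_ge_zero)
    qed (use f in auto)
    also have "(LINT y|lborel. f y * of_real (indicator {a<..<b} y)) = (LINT x:{a<..<b}|lborel. f x)"
      unfolding set_lebesgue_integral_def by (simp add: scaleR_conv_of_real mult.commute)
    finally have "(\<lambda>n. LINT x:{a<..<b}|lborel. B n x) \<longlonglongrightarrow> (LINT x:{a<..<b}|lborel. f x)"
      unfolding swap .
    moreover have "(\<lambda>n. LINT x:{a<..<b}|lborel. B n x) \<longlonglongrightarrow> (LINT x:{a<..<b}|lborel. h x)"
      unfolding set_lebesgue_integral_def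
    proof (rule integral_dominated_convergence[where w = "\<lambda>x. indicator {a<..<b} x *\<^sub>R M"])
      show "integrable lborel (\<lambda>x. indicator {a<..<b} x *\<^sub>R M)"
        by (simp add: emeasure_lborel_Ioo_less_top)
    qed (auto simp: B_bound indicator_def intro: B_lim)
    ultimately show ?thesis by (rule LIMSEQ_unique)
  qed
  then have "AE x in lborel. f x - h x = 0"
    using f_int h_int by (intro AE_zero_if_interval_integrals_zero) (auto simp: set_integral_diff)
  then show ?thesis by (simp add: h_def)
qed

section \<open>Weighted decay: integrability and essential suprema\<close>

lemma weight_function_abs:
  assumes "weight_function \<omega>"
  shows borel_measurable_weight_abs: "(\<lambda>x. \<omega> \<bar>x\<bar>) \<in> borel_measurable borel"
    and weight_abs_mono: "\<bar>x\<bar> \<le> \<bar>y\<bar> \<Longrightarrow> \<omega> \<bar>x\<bar> \<le> \<omega> \<bar>y\<bar>"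
    and weight_abs_nonneg: "0 \<le> \<omega> \<bar>x\<bar>"
proof -
  have cont: "continuous_on {0..} \<omega>" using assms by (simp add: weight_function_def)
  have "continuous_on UNIV (\<lambda>x. \<omega> \<bar>x\<bar>)"
    by (rule continuous_on_compose2[OF cont continuous_on_rabs[OF continuous_on_id]]) auto
  then show "(\<lambda>x. \<omega> \<bar>x\<bar>) \<in> borel_measurable borel"
    by (rule borel_measurable_continuous_onI)
qed (use assms in \<open>auto simp: weight_function_def mono_on_def\<close>)

text \<open>Since \<open>ln\<close> is little-o of the weight, \<open>\<omega> t\<close> eventually
  exceeds \<open>ln t\<close>, and the integrand falls below \<open>inverse (x\<^sup>2)\<close> far
  out.\<close>

lemma integrable_exp_weight:
  assumes w: "weight_function \<omega>"
  shows "integrable lborel (\<lambda>x. exp (- 4 * \<omega> \<bar>x\<bar>))"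
proof -
  note [measurable] = borel_measurable_weight_abs[OF w]
  have "\<forall>\<^sub>F t in at_top. norm (ln t) \<le> 1 * norm (\<omega> t)"
    using w by (intro landau_o.smallD) (auto simp: weight_function_def)
  then obtain T0 where T0: "\<And>t. t \<ge> T0 \<Longrightarrow> \<bar>ln t\<bar> \<le> \<bar>\<omega> t\<bar>"
    by (auto simp: eventually_at_top_linorder)
  \<comment> \<open>With \<open>T \<ge> 1\<close> the logarithm is nonnegative beyond
    \<open>T\<close>, and \<open>1 + T\<^sup>2\<close> is at least 2, the price of passing from
    \<open>inverse (x\<^sup>2)\<close> to \<open>inverse (1 + x\<^sup>2)\<close>.\<close>
  define T where "T = max 1 T0"
  have T: "\<bar>ln t\<bar> \<le> \<bar>\<omega> t\<bar>" if "t \<ge> T" for t using T0[of t] that by (simp add: T_def)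
  have T1: "T \<ge> 1" by (simp add: T_def)
  \<comment> \<open>One majorant serves both ranges: for \<open>\<bar>x\<bar> < T\<close> it is at
    least 1, while the exponential is at most 1.\<close>
  have bound: "exp (- 4 * \<omega> \<bar>x\<bar>) \<le> (1 + T\<^sup>2) * inverse (1 + x\<^sup>2)" for x
  proof (cases "\<bar>x\<bar> \<ge> T")
    case True
    then have x: "\<bar>x\<bar> \<ge> 1" using T1 by linarith
    have "ln \<bar>x\<bar> \<le> \<omega> \<bar>x\<bar>"
      using T[OF True] weight_abs_nonneg[OF w, of x] x ln_ge_zero[of "\<bar>x\<bar>"] by linarith
    then have "exp (- 4 * \<omega> \<bar>x\<bar>) \<le> exp (- (ln \<bar>x\<bar> + ln \<bar>x\<bar>))"
      using weight_abs_nonneg[OF w, of x] by (subst exp_le_cancel_iff) linarith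
    also have "\<dots> = inverse (x\<^sup>2)"
    proof -
      have "exp (ln \<bar>x\<bar>) = \<bar>x\<bar>" using x by simp
      then show ?thesis by (simp only: exp_minus exp_add) (simp add: power2_eq_square)
    qed
    also have "\<dots> \<le> 2 * inverse (1 + x\<^sup>2)"
    proof -
      have "1 \<le> x\<^sup>2" using x by (simp add: abs_le_square_iff[of 1 x, simplified])
      then have "0 < x\<^sup>2" by linarith
      with \<open>1 \<le> x\<^sup>2\<close> show ?thesis by (auto simp: divide_simps)
    qed
    also have "\<dots> \<le> (1 + T\<^sup>2) * inverse (1 + x\<^sup>2)"
      using one_le_power[OF T1, of 2] by (intro mult_right_mono) (auto intro: add_nonneg_nonneg)
    finally show ?thesis .
  next
    case False
    then have "x\<^sup>2 \<le> T\<^sup>2" using T1 by (intro abs_le_square_iff[THEN iffD1]) linarith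
    then have "1 \<le> (1 + T\<^sup>2) * inverse (1 + x\<^sup>2)"
      by (simp add: field_simps add_pos_nonneg)
    moreover have "exp (- 4 * \<omega> \<bar>x\<bar>) \<le> 1" using weight_abs_nonneg[OF w, of x] by simp
    ultimately show ?thesis by linarith
  qed
  have "integrable lborel (\<lambda>x::real. (1 + T\<^sup>2) * inverse (1 + x\<^sup>2))"
    using integrable_inverse_1_plus_square by (simp add: set_integrable_def)
  then show ?thesis
    by (rule Bochner_Integration.integrable_bound) (use bound in \<open>auto intro: order_trans[OF _ abs_ge_self]\<close>)
qed

text \<open>\<open>real_of_ereal\<close> sends infinite values to 0, so the number \<open>N\<close>
  is meaningful only once the essential supremum is known to be finite: \<open>M\<close> caps it
  above, nonnegativity of the function below.\<close>

lemma esssup_weighted_bound: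
  fixes g :: "real \<Rightarrow> complex" and h :: "real \<Rightarrow> real"
  assumes [measurable]: "g \<in> borel_measurable borel" "h \<in> borel_measurable borel"
    and ex: "\<exists>M. AE x in lborel. cmod (g x) \<le> M * exp (- h x)"
  defines "N \<equiv> real_of_ereal (esssup lborel (\<lambda>x. ereal (cmod (g x * of_real (exp (h x))))))"
  shows "0 \<le> N" and "AE x in lborel. cmod (g x) \<le> N * exp (- h x)"
proof -
  let ?u = "\<lambda>x. ereal (cmod (g x * of_real (exp (h x))))"
  obtain M where "AE x in lborel. cmod (g x) \<le> M * exp (- h x)" using ex by blast
  then have "AE x in lborel. ?u x \<le> ereal M"
    by eventually_elim (simp add: norm_mult exp_minus field_simps)
  then have up: "esssup lborel ?u \<le> ereal M" by (intro esssup_I) auto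
  \<comment> \<open>An almost everywhere statement independent of \<open>x\<close> holds outright
    because Lebesgue measure is nonzero.\<close>
  have "AE x in (lborel :: real measure). 0 \<le> esssup lborel ?u"
    using esssup_AE[of ?u lborel] by (rule eventually_mono) (erule order_trans[rotated], simp)
  then have low: "0 \<le> esssup lborel ?u"
    by (simp add: eventually_const_iff ae_filter_eq_bot_iff)
  then show "0 \<le> N" unfolding N_def by (rule real_of_ereal_pos)
  have eq: "esssup lborel ?u = ereal N"
    unfolding N_def using up low by (cases "esssup lborel ?u") auto
  show "AE x in lborel. cmod (g x) \<le> N * exp (- h x)"
    using esssup_AE[of ?u lborel] unfolding eq
    by eventually_elim (simp add: norm_mult exp_minus field_simps)
qed

text \<open>\<open>r\<close> is the midpoint of \<open>y\<close> and \<open>2 * r - y\<close>, so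
  the point of larger modulus supplies the decay at \<open>r\<close>. The other exponential is at
  most the sum of both, whose integrals agree by reflection; hence the factor 2.\<close>

lemma reflected_product_bound:
  fixes g :: "real \<Rightarrow> complex"
  assumes w: "weight_function \<omega>" and [measurable]: "g \<in> borel_measurable borel"
    and A: "0 \<le> A" and g: "AE x in lborel. cmod (g x) \<le> A * exp (- 4 * \<omega> \<bar>x\<bar>)"
  shows "(LINT y|lborel. cmod (g y) * cmod (g (2 * r - y)))
    \<le> 2 * (LINT x|lborel. exp (- 4 * \<omega> \<bar>x\<bar>)) * (A\<^sup>2 * exp (- 4 * \<omega> \<bar>r\<bar>))"
proof -
  note [measurable] = borel_measurable_weight_abs[OF w]
  let ?E = "\<lambda>x. exp (- 4 * \<omega> \<bar>x\<bar>)"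
  have int: "integrable lborel ?E" by (rule integrable_exp_weight[OF w])
  have int': "integrable lborel (\<lambda>y. ?E (2 * r - y))"
    using lborel_integrable_real_affine[OF int, of "-1" "2 * r"] by simp
  have eq': "(LINT y|lborel. ?E (2 * r - y)) = (LINT y|lborel. ?E y)"
    using lborel_integral_real_affine[of "-1" ?E "2 * r"] by simp
  \<comment> \<open>Reflection preserves null sets, so the bound also holds at the reflected point
    for almost every \<open>y\<close>.\<close>
  have "AE y in lborel. cmod (g (2 * r + (-1) * y)) \<le> A * ?E (2 * r + (-1) * y)"
    using g by (intro AE_borel_affine) auto
  with g have bound: "AE y in lborel. cmod (g y) * cmod (g (2 * r - y)) \<le> A\<^sup>2 * ?E r * (?E y + ?E (2 * r - y))"
  proof eventually_elim
    case (elim y)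
    have "cmod (g y) * cmod (g (2 * r - y)) \<le> (A * ?E y) * (A * ?E (2 * r - y))"
      using elim A by (intro mult_mono) auto
    also have "\<dots> = A\<^sup>2 * (?E y * ?E (2 * r - y))" by (simp add: power2_eq_square)
    also have "?E y * ?E (2 * r - y) \<le> ?E r * (?E y + ?E (2 * r - y))"
    proof (cases "\<bar>r\<bar> \<le> \<bar>y\<bar>")
      case True
      then have "?E y \<le> ?E r" using weight_abs_mono[OF w] by simp
      then have "?E y * ?E (2 * r - y) \<le> ?E r * ?E (2 * r - y)" by (rule mult_right_mono) simp
      then show ?thesis by (simp add: distrib_left add_increasing)
    next
      case False
      then have "\<bar>r\<bar> \<le> \<bar>2 * r - y\<bar>" by linarith
      then have "?E (2 * r - y) \<le> ?E r" using weight_abs_mono[OF w] by simp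
      then have "?E (2 * r - y) * ?E y \<le> ?E r * ?E y" by (rule mult_right_mono) simp
      then show ?thesis by (simp add: distrib_left add_increasing2 mult.commute)
    qed
    finally show ?case by (simp add: mult_left_mono mult.assoc)
  qed
  have int_bound: "integrable lborel (\<lambda>y. A\<^sup>2 * ?E r * (?E y + ?E (2 * r - y)))"
    using int int' by simp
  have "(LINT y|lborel. cmod (g y) * cmod (g (2 * r - y)))
      \<le> (LINT y|lborel. A\<^sup>2 * ?E r * (?E y + ?E (2 * r - y)))"
    using bound
    by (intro integral_mono_AE Bochner_Integration.integrable_bound[OF int_bound] int_bound) auto
  also have "\<dots> = A\<^sup>2 * ?E r * (2 * (LINT y|lborel. ?E y))"
    using int int' eq' by (subst integral_mult_right_zero) simp
  finally show ?thesis by (simp add: mult_ac)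
qed

section \<open>Estimates of the Wigner transform\<close>

text \<open>Substitute \<open>x = 2 * q - 2 * y\<close>: the Jacobian 2 turns
  \<open>1 / (2 * pi)\<close> into \<open>1 / pi\<close>, and the phase \<open>p * x\<close> becomes
  \<open>2 * p * (q - y)\<close>.\<close>

lemma wigner_convolution:
  "wigner f q p = of_real (1 / pi) * (LINT y|lborel. iexp (2 * p * (q - y)) * f y * cnj (f (2 * q - y)))"
proof -
  have "(LINT x|lborel. exp (\<i> * of_real (p * x)) * f (q - x / 2) * cnj (f (q + x / 2)))
    = 2 * (LINT y|lborel. iexp (2 * p * (q - y)) * f y * cnj (f (2 * q - y)))"
    by (subst lborel_integral_real_affine[where c = "-2" and t = "2 * q"])
      (simp_all add: scaleR_conv_of_real algebra_simps diff_divide_distrib add_divide_distrib)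
  then show ?thesis unfolding wigner_def by simp
qed

lemma wigner_le_position:
  "cmod (wigner f q p) \<le> (LINT y|lborel. cmod (f y) * cmod (f (2 * q - y))) / pi"
proof -
  have "cmod (LINT y|lborel. iexp (2 * p * (q - y)) * f y * cnj (f (2 * q - y)))
      \<le> (LINT y|lborel. cmod (f y) * cmod (f (2 * q - y)))"
    by (rule order_trans[OF integral_norm_bound]) (simp add: norm_mult)
  then show ?thesis by (simp add: wigner_convolution norm_mult norm_divide divide_right_mono)
qed

text \<open>Inversion is inserted for the conjugated factor and \<open>y\<close> is integrated
  first. The phase \<open>2 * p * (q - y) - (2 * q - y) * \<xi>\<close> equals
  \<open>2 * q * (p - \<xi>) - (2 * p - \<xi>) * y\<close>, so the integral over \<open>y\<close> is
  the transform at \<open>2 * p - \<xi>\<close>.\<close>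

lemma wigner_le_momentum:
  assumes f: "integrable lborel f" and g: "integrable lborel (fourier_transform f)"
  shows "cmod (wigner f q p)
    \<le> (LINT \<xi>|lborel. cmod (fourier_transform f \<xi>) * cmod (fourier_transform f (2 * p - \<xi>))) / pi"
proof -
  let ?F = "fourier_transform f"
  define c where "c = complex_of_real (1 / sqrt (2 * pi))"
  define K where "K y \<xi> = iexp (2 * p * (q - y)) * iexp (- ((2 * q - y) * \<xi>))" for y \<xi>
  have [measurable]: "f \<in> borel_measurable borel" using f by auto
  have [measurable]: "cnj \<in> borel_measurable borel"
    by (intro borel_measurable_continuous_onI continuous_intros)
  \<comment> \<open>Inversion holds only almost everywhere, but this survives the reflection and
    suffices under the integral over \<open>y\<close>.\<close>
  have "AE y in lborel. f (2 * q + (-1) * y)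
      = c * (LINT \<xi>|lborel. ?F \<xi> * iexp ((2 * q + (-1) * y) * \<xi>))"
    unfolding c_def using fourier_inversion_AE[OF f g] by (intro AE_borel_affine) auto
  then have "AE y in lborel. iexp (2 * p * (q - y)) * f y * cnj (f (2 * q - y))
      = c * (f y * (LINT \<xi>|lborel. cnj (?F \<xi>) * K y \<xi>))"
  proof eventually_elim
    case (elim y)
    have "cnj (f (2 * q - y)) = c * (LINT \<xi>|lborel. cnj (?F \<xi> * iexp ((2 * q - y) * \<xi>)))"
      using elim by (simp add: c_def del: complex_cnj_mult flip: integral_cnj)
    moreover have "cnj (?F \<xi>) * K y \<xi> = iexp (2 * p * (q - y)) * cnj (?F \<xi> * iexp ((2 * q - y) * \<xi>))" for \<xi>
      by (simp add: K_def exp_cnj)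
    ultimately show ?case by (simp only: integral_mult_right_zero) (simp only: ac_simps)
  qed
  then have "(LINT y|lborel. iexp (2 * p * (q - y)) * f y * cnj (f (2 * q - y)))
      = (LINT y|lborel. c * (f y * (LINT \<xi>|lborel. cnj (?F \<xi>) * K y \<xi>)))"
    unfolding K_def by (intro integral_cong_AE) measurable
  also have "\<dots> = c * (LINT \<xi>|lborel. cnj (?F \<xi>) * (LINT y|lborel. f y * K y \<xi>))"
    using f g unfolding integral_mult_right_zero
    by (intro arg_cong[where f = "(*) c"] Fubini_product_kernel[where C = 1])
      (auto simp: K_def norm_mult)
  also have "\<dots> = (LINT \<xi>|lborel. cnj (?F \<xi>) * (iexp (2 * q * (p - \<xi>)) * ?F (2 * p - \<xi>)))"
  proof -
    have "f y * K y \<xi> = iexp (2 * q * (p - \<xi>)) * (f y * exp (- \<i> * of_real ((2 * p - \<xi>) * y)))" for y \<xi>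
      by (simp add: K_def mult.left_commute flip: exp_add) (simp add: algebra_simps)
    then have "c * (cnj (?F \<xi>) * (LINT y|lborel. f y * K y \<xi>))
        = cnj (?F \<xi>) * (iexp (2 * q * (p - \<xi>)) * ?F (2 * p - \<xi>))" for \<xi>
      by (simp only: integral_mult_right_zero) (simp add: fourier_transform_def c_def)
    then show ?thesis by (simp only: flip: integral_mult_right_zero)
  qed
  finally have "cmod (LINT y|lborel. iexp (2 * p * (q - y)) * f y * cnj (f (2 * q - y)))
      \<le> (LINT \<xi>|lborel. cmod (?F \<xi>) * cmod (?F (2 * p - \<xi>)))"
    by (simp only:) (rule order_trans[OF integral_norm_bound], simp add: norm_mult)
  then show ?thesis by (simp add: wigner_convolution norm_mult norm_divide divide_right_mono)
qed

theorem wigner_weighted_bound: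
  assumes w: "weight_function \<omega>" and f: "f \<in> S_space 4 \<omega>"
  defines "K \<equiv> 2 * (LINT x|lborel. exp (- 4 * \<omega> \<bar>x\<bar>)) / pi"
  shows "cmod (wigner f q p) * exp (2 * (\<omega> \<bar>q\<bar> + \<omega> \<bar>p\<bar>)) \<le> K * (S_norm 4 \<omega> f)\<^sup>2"
    and "0 \<le> S_norm 4 \<omega> f"
proof -
  note [measurable] = borel_measurable_weight_abs[OF w]
  have [measurable]: "f \<in> borel_measurable borel" using f by (auto simp: S_space_def)
  let ?F = "fourier_transform f"
  define A where "A = real_of_ereal (esssup lborel (\<lambda>x. ereal (cmod (f x * of_real (exp (4 * \<omega> \<bar>x\<bar>))))))"
  define B where "B = real_of_ereal (esssup lborel (\<lambda>\<xi>. ereal (cmod (?F \<xi> * of_real (exp (4 * \<omega> \<bar>\<xi>\<bar>))))))"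
  have norm: "S_norm 4 \<omega> f = A + B" by (simp add: S_norm_def A_def B_def)
  have A: "0 \<le> A" "AE x in lborel. cmod (f x) \<le> A * exp (- 4 * \<omega> \<bar>x\<bar>)"
    using esssup_weighted_bound[of f "\<lambda>x. 4 * \<omega> \<bar>x\<bar>"] f by (simp_all add: S_space_def A_def)
  have B: "0 \<le> B" "AE x in lborel. cmod (?F x) \<le> B * exp (- 4 * \<omega> \<bar>x\<bar>)"
    using esssup_weighted_bound[of ?F "\<lambda>x. 4 * \<omega> \<bar>x\<bar>"] f by (simp_all add: S_space_def B_def)
  show "0 \<le> S_norm 4 \<omega> f" using A B norm by simp
  \<comment> \<open>Applied to \<open>f\<close> and to its transform, this provides the
    integrability that inversion requires.\<close>
  have int: "integrable lborel g"
    if "g \<in> borel_measurable borel" "AE x in lborel. cmod (g x) \<le> M * exp (- 4 * \<omega> \<bar>x\<bar>)" for g M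
  proof (rule Bochner_Integration.integrable_bound)
    show "integrable lborel (\<lambda>x. M * exp (- 4 * \<omega> \<bar>x\<bar>))"
      by (intro integrable_mult_right integrable_exp_weight[OF w])
    show "AE x in lborel. norm (g x) \<le> norm (M * exp (- 4 * \<omega> \<bar>x\<bar>))"
      using that(2) by eventually_elim (auto intro: order_trans[OF _ abs_ge_self])
  qed (use that in simp)
  have "K \<ge> 0" unfolding K_def by simp
  define W where "W = cmod (wigner f q p)"
  have "W \<ge> 0" by (simp add: W_def)
  have q: "W \<le> K * (A\<^sup>2 * exp (- 4 * \<omega> \<bar>q\<bar>))"
    using order_trans[OF wigner_le_position divide_right_mono[OF reflected_product_bound[OF w _ A]]]
    by (simp add: W_def K_def)
  have p: "W \<le> K * (B\<^sup>2 * exp (- 4 * \<omega> \<bar>p\<bar>))"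
    using order_trans[OF wigner_le_momentum[OF int[OF _ A(2)] int[OF _ B(2)]]
        divide_right_mono[OF reflected_product_bound[OF w _ B]]]
    by (simp add: W_def K_def)
  \<comment> \<open>Multiplying the position and momentum bounds and taking the root halves each
    exponent from 4 to 2.\<close>
  have "W\<^sup>2 \<le> (K * (A\<^sup>2 * exp (- 4 * \<omega> \<bar>q\<bar>))) * (K * (B\<^sup>2 * exp (- 4 * \<omega> \<bar>p\<bar>)))"
    unfolding power2_eq_square[of W] using \<open>W \<ge> 0\<close> q p by (intro mult_mono) auto
  also have "\<dots> = (K * (A * B))\<^sup>2 * (exp (- 4 * \<omega> \<bar>q\<bar>) * exp (- 4 * \<omega> \<bar>p\<bar>))"
    by (simp only: power2_eq_square ac_simps)
  also have "exp (- 4 * \<omega> \<bar>q\<bar>) * exp (- 4 * \<omega> \<bar>p\<bar>) = (exp (- 2 * (\<omega> \<bar>q\<bar> + \<omega> \<bar>p\<bar>)))\<^sup>2"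
    by (simp add: power2_eq_square flip: exp_add)
  also have "(K * (A * B))\<^sup>2 * \<dots> = (K * (A * B) * exp (- 2 * (\<omega> \<bar>q\<bar> + \<omega> \<bar>p\<bar>)))\<^sup>2"
    by (simp only: power_mult_distrib)
  finally have "W \<le> K * (A * B) * exp (- 2 * (\<omega> \<bar>q\<bar> + \<omega> \<bar>p\<bar>))"
    using \<open>K \<ge> 0\<close> A B by (intro power2_le_imp_le[of W]) auto
  then have "W * exp (2 * (\<omega> \<bar>q\<bar> + \<omega> \<bar>p\<bar>))
      \<le> K * (A * B) * exp (- 2 * (\<omega> \<bar>q\<bar> + \<omega> \<bar>p\<bar>)) * exp (2 * (\<omega> \<bar>q\<bar> + \<omega> \<bar>p\<bar>))"
    by (rule mult_right_mono) simp
  also have "\<dots> = K * (A * B)"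
    by (simp add: mult.assoc flip: exp_add)
  also have "\<dots> \<le> K * (A + B)\<^sup>2"
    using \<open>K \<ge> 0\<close> A B by (intro mult_left_mono) (auto simp: power2_eq_square algebra_simps)
  finally show "cmod (wigner f q p) * exp (2 * (\<omega> \<bar>q\<bar> + \<omega> \<bar>p\<bar>)) \<le> K * (S_norm 4 \<omega> f)\<^sup>2"
    by (simp add: W_def norm)
qed

text \<open>\<open>Cbar\<close> is chosen before \<open>\<omega>\<close> and sees only its class,
  which encodes the dependence on the class alone; \<open>C\<close> is chosen after
  \<open>\<omega>\<close>. The boundedness clause ensures that the real-valued \<open>SUP\<close> is
  a genuine supremum.\<close>

theorem proposition4p1:
  shows "\<exists>Cbar :: (real \<Rightarrow> real) set \<Rightarrow> real.
    \<forall>\<omega> :: real \<Rightarrow> real.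
      weight_function \<omega> \<and> Limsup at_top (\<lambda>t. ereal (\<omega> t / t\<^sup>2)) < ereal (1 / 2) \<longrightarrow>
      0 < Cbar (weight_class \<omega>) \<and>
      (\<exists>C :: real. \<forall>f \<in> S_space (Cbar (weight_class \<omega>)) \<omega>.
         bdd_above (range (\<lambda>(q, p). cmod (wigner f q p) * exp (2 * (\<omega> \<bar>q\<bar> + \<omega> \<bar>p\<bar>)))) \<and>
         sqrt (SUP (q, p) \<in> UNIV. cmod (wigner f q p) * exp (2 * (\<omega> \<bar>q\<bar> + \<omega> \<bar>p\<bar>)))
           \<le> C * S_norm (Cbar (weight_class \<omega>)) \<omega> f)"
\<comment> \<open>The value 4 is twice the target rate 2, since the geometric mean shares the decay
  between \<open>q\<close> and \<open>p\<close>.\<close>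
proof (intro exI[of _ "\<lambda>_. 4"] allI impI conjI)
  fix \<omega> :: "real \<Rightarrow> real"
  assume "weight_function \<omega> \<and> Limsup at_top (\<lambda>t. ereal (\<omega> t / t\<^sup>2)) < ereal (1 / 2)"
  then have w: "weight_function \<omega>" by simp
  define K where "K = 2 * (LINT x|lborel. exp (- 4 * \<omega> \<bar>x\<bar>)) / pi"
  show "\<exists>C. \<forall>f \<in> S_space 4 \<omega>.
         bdd_above (range (\<lambda>(q, p). cmod (wigner f q p) * exp (2 * (\<omega> \<bar>q\<bar> + \<omega> \<bar>p\<bar>)))) \<and>
         sqrt (SUP (q, p) \<in> UNIV. cmod (wigner f q p) * exp (2 * (\<omega> \<bar>q\<bar> + \<omega> \<bar>p\<bar>)))
           \<le> C * S_norm 4 \<omega> f"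
  \<comment> \<open>The supremum is at most \<open>K\<close> times the squared norm; as the norm is
    nonnegative, the root is \<open>sqrt K\<close> times the norm.\<close>
  proof (intro exI[of _ "sqrt K"] ballI conjI)
    fix f assume f: "f \<in> S_space 4 \<omega>"
    note bound = wigner_weighted_bound[OF w f, folded K_def]
    show "bdd_above (range (\<lambda>(q, p). cmod (wigner f q p) * exp (2 * (\<omega> \<bar>q\<bar> + \<omega> \<bar>p\<bar>))))"
      using bound(1) by (intro bdd_aboveI[of _ "K * (S_norm 4 \<omega> f)\<^sup>2"]) auto
    have "(SUP (q, p) \<in> UNIV. cmod (wigner f q p) * exp (2 * (\<omega> \<bar>q\<bar> + \<omega> \<bar>p\<bar>)))
        \<le> K * (S_norm 4 \<omega> f)\<^sup>2"
      using bound(1) by (intro cSUP_least) auto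
    then show "sqrt (SUP (q, p) \<in> UNIV. cmod (wigner f q p) * exp (2 * (\<omega> \<bar>q\<bar> + \<omega> \<bar>p\<bar>)))
        \<le> sqrt K * S_norm 4 \<omega> f"
      using bound(2) real_sqrt_le_mono by (fastforce simp: real_sqrt_mult)
  qed
qed simp

end
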